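(* Let $G$ be any group and let $a,b\in L_3(G)$ be left $3$-Engel elements of $G$. Then the subgroup $\langle a,b\rangle$ is nilpotent of class at most $4$.
   Context: For elements $a,b$ of a group $G$ put $[a,{}_0 b]:=a$, $[a,b]=[a,{}_1 b]:=a^{-1}b^{-1}ab$, and $[a,{}_n b]:=[[a,{}_{n-1}b],b]$ for $n>0$. An element $x\in G$ is a left $n$-Engel element if $[g,{}_n x]=1$ for all $g\in G$; $L_n(G)$ denotes the set of all left $n$-Engel elements of $G$. *)

theory Defs
  imports "HOL-Algebra.Algebra"
begin

definition commutator :: "('a, 'b) monoid_scheme \<Rightarrow> 'a \<Rightarrow> 'a \<Rightarrow> 'a" where
  "commutator G x y = inv\<^bsub>G\<^esub> x \<otimes>\<^bsub>G\<^esub> inv\<^bsub>G\<^esub> y \<otimes>\<^bsub>G\<^esub> x \<otimes>\<^bsub>G\<^esub> y"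

primrec iter_commutator :: "('a, 'b) monoid_scheme \<Rightarrow> nat \<Rightarrow> 'a \<Rightarrow> 'a \<Rightarrow> 'a" where
  "iter_commutator G 0 x y = x"
| "iter_commutator G (Suc n) x y = commutator G (iter_commutator G n x y) y"

definition left_engel_set :: "('a, 'b) monoid_scheme \<Rightarrow> nat \<Rightarrow> 'a set" where
  "left_engel_set G n =
     {x \<in> carrier G. \<forall>g \<in> carrier G. iter_commutator G n g x = \<one>\<^bsub>G\<^esub>}"

(* Indexing starts at 0: \<open>lower_central_series G n\<close> is the term usually written
   \<open>gamma_(n+1)(G)\<close>, so class at most n means that it is trivial. *)
primrec lower_central_series :: "('a, 'b) monoid_scheme \<Rightarrow> nat \<Rightarrow> 'a set" where
  "lower_central_series G 0 = carrier G"
| "lower_central_series G (Suc n) =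
     generate G {commutator G x y | x y. x \<in> lower_central_series G n \<and> y \<in> carrier G}"

definition nilpotent_class_le :: "('a, 'b) monoid_scheme \<Rightarrow> nat \<Rightarrow> bool" where
  "nilpotent_class_le G n \<longleftrightarrow> group G \<and> lower_central_series G n = {\<one>\<^bsub>G\<^esub>}"

end

theory Submission
  imports Defs
begin

text \<open>
  Write \<open>x\<^sup>g\<close> for \<open>g\<^sup>-\<^sup>1 x g\<close>. An element is left 3-Engel exactly when it generates a group of class
  at most 2 together with each of its conjugates; the half used here is
  \<open>left_3_engel_class_2\<close>: \<open>[a\<^sup>g, a]\<close> commutes with \<open>a\<close> and with \<open>a\<^sup>g\<close>. The hypotheses are thus
  relations of this kind, one for each conjugate of \<open>a\<close> and of \<open>b\<close>, and finitely many of them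
  suffice.

  Put \<open>u = [a,b]\<close>, \<open>v = [u,a]\<close>, \<open>w = [u,b]\<close>. Since \<open>v = [a\<^sup>b, a]\<close> and \<open>w = [b\<^sup>a, b]\<^sup>-\<^sup>1\<close>, the
  conjugates \<open>a\<^sup>b\<close> and \<open>b\<^sup>a\<close> show that \<open>v\<close> commutes with \<open>a\<close> and \<open>u\<close>, and \<open>w\<close> with \<open>b\<close> and \<open>u\<close>.
  Hence class at most 4 follows as soon as the two elements \<open>t = [w,a]\<close> and \<open>t' = [v\<^sup>-\<^sup>1, b]\<close> are
  central: then \<open>v\<close> and \<open>w\<close> lie in the second term of the upper central series, \<open>u\<close> in the third, and
  \<open>a\<close> and \<open>b\<close> in the fourth.

  Let \<open>s = [t,a]\<close>. Computing \<open>u\<^sup>a\<^sup>b\<close> and \<open>u\<^sup>b\<^sup>a\<close> in two ways expresses \<open>w\<^sup>a\<close> through \<open>v\<close>, \<open>w\<close> and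
  \<open>z = v\<^sup>x\<close> with \<open>x = b\<^sup>-\<^sup>1\<close>, and so gives \<open>v\<^sup>w\<close> and \<open>z\<^sup>w\<close> in terms of \<open>v\<close>, \<open>z\<close>, \<open>t\<close>. The conjugate \<open>a\<^sup>w\<close>
  then makes \<open>s\<close> commute with \<open>a\<close>, \<open>t\<close>, \<open>v\<close>, \<open>z\<close> and gives \<open>[t,v] = s\<close>, \<open>[t,z] = s\<^sup>-\<^sup>1\<close>. With
  these rules the action of \<open>b\<close> on \<open>v\<close> can be computed (\<open>conj_v_b\<close>), the conjugate of \<open>a\<close> by \<open>b\<^sup>2\<close>
  yields \<open>s\<^sup>3 = 1\<close> (\<open>s_cube\<close>), and then \<open>[t,b] = s\<close>, \<open>s\<^sup>b = s\<^sup>-\<^sup>1\<close>, \<open>[t',a] = s\<close>.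

  Exchanging \<open>a\<close> and \<open>b\<close> exchanges \<open>t\<close> and \<open>t'\<close>. By \<open>[t',a] = s\<close> and the mirror image of
  \<open>[t,b] = s\<close>, the element \<open>s\<close> is its own mirror image \<open>[t',b]\<close>. So the mirror image of
  \<open>s\<^sup>b = s\<^sup>-\<^sup>1\<close> reads \<open>s\<^sup>a = s\<^sup>-\<^sup>1\<close>, whereas \<open>s\<^sup>a = s\<close>; thus \<open>s\<^sup>2 = 1 = s\<^sup>3\<close>, \<open>s\<close> is trivial, and \<open>t\<close>
  and \<open>t'\<close> are central (\<open>t_t'_central\<close>).
\<close>

section \<open>Conjugation and commutators\<close>

context group
begin

text \<open>
  Associating to the right, pushing inverses inwards and cancelling adjacent inverse pairs reduces
  words in a free group to normal form, so simplification with \<open>free_reduce\<close> decides identities that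
  hold in all groups.
\<close>

lemma inv_mult_cancel: "x \<in> carrier G \<Longrightarrow> y \<in> carrier G \<Longrightarrow> inv x \<otimes> (x \<otimes> y) = y"
  by (simp flip: m_assoc)

lemma mult_inv_cancel: "x \<in> carrier G \<Longrightarrow> y \<in> carrier G \<Longrightarrow> x \<otimes> (inv x \<otimes> y) = y"
  by (simp flip: m_assoc)

lemmas free_reduce = m_assoc inv_mult_group inv_mult_cancel mult_inv_cancel

definition conjugate :: "'a \<Rightarrow> 'a \<Rightarrow> 'a" (infixl \<open>\<Up>\<close> 80)
  where "x \<Up> g = inv g \<otimes> x \<otimes> g"

lemma conj_closed [simp]: "x \<in> carrier G \<Longrightarrow> g \<in> carrier G \<Longrightarrow> x \<Up> g \<in> carrier G"
  by (simp add: conjugate_def)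

lemma commutator_closed [simp]:
  "x \<in> carrier G \<Longrightarrow> y \<in> carrier G \<Longrightarrow> commutator G x y \<in> carrier G"
  by (simp add: commutator_def)

lemma conj_self [simp]: "x \<in> carrier G \<Longrightarrow> x \<Up> x = x"
  by (simp add: conjugate_def)

lemma conj_one [simp]: "x \<in> carrier G \<Longrightarrow> x \<Up> \<one> = x" "g \<in> carrier G \<Longrightarrow> \<one> \<Up> g = \<one>"
  by (simp_all add: conjugate_def)

lemma conj_mult:
  "\<lbrakk>x \<in> carrier G; y \<in> carrier G; g \<in> carrier G\<rbrakk> \<Longrightarrow> (x \<otimes> y) \<Up> g = x \<Up> g \<otimes> y \<Up> g"
  by (simp add: conjugate_def free_reduce)

lemma conj_inv:
  "x \<in> carrier G \<Longrightarrow> g \<in> carrier G \<Longrightarrow> inv x \<Up> g = inv (x \<Up> g)"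
  by (simp add: conjugate_def free_reduce)

lemma conj_conj:
  "\<lbrakk>x \<in> carrier G; g \<in> carrier G; h \<in> carrier G\<rbrakk> \<Longrightarrow> x \<Up> g \<Up> h = x \<Up> (g \<otimes> h)"
  by (simp add: conjugate_def free_reduce)

lemma conj_commutator:
  "\<lbrakk>x \<in> carrier G; y \<in> carrier G; g \<in> carrier G\<rbrakk>
    \<Longrightarrow> commutator G x y \<Up> g = commutator G (x \<Up> g) (y \<Up> g)"
  by (simp add: commutator_def conj_mult conj_inv)

lemma conj_cancel [simp]:
  "x \<in> carrier G \<Longrightarrow> g \<in> carrier G \<Longrightarrow> x \<Up> g \<Up> (inv g) = x"
  "x \<in> carrier G \<Longrightarrow> g \<in> carrier G \<Longrightarrow> x \<Up> (inv g) \<Up> g = x"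
  by (simp_all add: conj_conj)

lemma conj_inject:
  "\<lbrakk>x \<in> carrier G; y \<in> carrier G; g \<in> carrier G\<rbrakk> \<Longrightarrow> x \<Up> g = y \<Up> g \<longleftrightarrow> x = y"
  by (metis conj_cancel(1))

lemma conj_eq_self_iff:
  "x \<in> carrier G \<Longrightarrow> g \<in> carrier G \<Longrightarrow> x \<Up> g = x \<longleftrightarrow> x \<otimes> g = g \<otimes> x"
  by (simp add: conjugate_def m_assoc inv_solve_left')

lemma conj_eq_self_sym:
  "x \<in> carrier G \<Longrightarrow> g \<in> carrier G \<Longrightarrow> x \<Up> g = x \<longleftrightarrow> g \<Up> x = g"
  by (auto simp: conj_eq_self_iff)

lemma conj_inv_eq_self:
  "x \<in> carrier G \<Longrightarrow> g \<in> carrier G \<Longrightarrow> x \<Up> (inv g) = x \<longleftrightarrow> x \<Up> g = x"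
  by (metis conj_cancel inv_closed)

lemma conj_eq_mult_commutator:
  "x \<in> carrier G \<Longrightarrow> g \<in> carrier G \<Longrightarrow> x \<Up> g = x \<otimes> commutator G x g"
  by (simp add: conjugate_def commutator_def free_reduce)

lemma commutator_eq_conj:
  "x \<in> carrier G \<Longrightarrow> g \<in> carrier G \<Longrightarrow> commutator G x g = inv x \<otimes> x \<Up> g"
  by (simp add: conjugate_def commutator_def free_reduce)

lemma commutator_eq_iff:
  "\<lbrakk>x \<in> carrier G; g \<in> carrier G; c \<in> carrier G\<rbrakk> \<Longrightarrow> commutator G x g = c \<longleftrightarrow> x \<Up> g = x \<otimes> c"
  by (auto simp: commutator_eq_conj inv_mult_cancel mult_inv_cancel)

lemma inv_commutator:
  "x \<in> carrier G \<Longrightarrow> y \<in> carrier G \<Longrightarrow> inv (commutator G x y) = commutator G y x"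
  by (simp add: commutator_def free_reduce)

section \<open>Left 3-Engel elements and their conjugates\<close>

text \<open>
  With \<open>p = a\<^sup>g\<close> and \<open>q = p a p\<^sup>-\<^sup>1\<close> one has \<open>[g,a,a] = (q\<^sup>a)\<^sup>-\<^sup>1 a\<close> in every group. So \<open>[g,a,a]\<close>
  commutes with \<open>a\<close> iff \<open>q\<close> does, that is, iff \<open>a\<close> commutes with \<open>a\<^sup>p\<close>.
\<close>

lemma left_3_engel_commutes_conj:
  assumes a: "a \<in> left_engel_set G 3" and g: "g \<in> carrier G"
  shows "a \<Up> (a \<Up> g) \<Up> a = a \<Up> (a \<Up> g)"
proof -
  have ac [simp]: "a \<in> carrier G" and engel: "iter_commutator G 3 g a = \<one>"
    using a g by (auto simp: left_engel_set_def)
  define p where "p = a \<Up> g"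
  have p [simp]: "p \<in> carrier G" using g by (simp add: p_def)
  define q where "q = a \<Up> (inv p)"
  have q [simp]: "q \<in> carrier G" by (simp add: q_def)
  have "commutator G (commutator G g a) a = inv (q \<Up> a) \<otimes> a"
    using g by (simp add: commutator_def conjugate_def p_def q_def free_reduce)
  moreover have "commutator G (commutator G g a) a \<Up> a = commutator G (commutator G g a) a"
    using engel g by (simp add: numeral_3_eq_3 commutator_eq_iff)
  ultimately have "inv (q \<Up> a \<Up> a) \<otimes> a = inv (q \<Up> a) \<otimes> a"
    by (simp add: conj_mult conj_inv)
  then have "q \<Up> a \<Up> a = q \<Up> a"
    by (simp add: inv_inj inj_on_eq_iff[OF inv_inj])
  then have "q \<Up> a = q"
    by (simp add: conj_inject)
  then have "(q \<Up> p) \<Up> (a \<Up> p) = q \<Up> p"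
    by (metis ac p q conj_conj conj_eq_self_iff conj_mult conj_closed)
  then have "a \<Up> (a \<Up> p) = a"
    by (simp add: q_def)
  then show ?thesis
    using g by (simp add: conj_eq_self_sym p_def)
qed

text \<open>
  With \<open>p = a\<^sup>g\<close> the commutator is both \<open>(a\<^sup>p)\<^sup>-\<^sup>1 a\<close> and \<open>p\<^sup>-\<^sup>1 p\<^sup>a\<close>. By the previous lemma \<open>a\<close>
  commutes with \<open>a\<^sup>p\<close>; the same lemma for \<open>g\<^sup>-\<^sup>1\<close>, conjugated by \<open>g\<close>, says that \<open>p\<close> commutes with
  \<open>p\<^sup>a\<close>.
\<close>

lemma left_3_engel_class_2:
  assumes a: "a \<in> left_engel_set G 3" and g: "g \<in> carrier G"
  shows "commutator G (a \<Up> g) a \<Up> a = commutator G (a \<Up> g) a"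
    and "commutator G (a \<Up> g) a \<Up> (a \<Up> g) = commutator G (a \<Up> g) a"
proof -
  have ac [simp]: "a \<in> carrier G"
    using a by (auto simp: left_engel_set_def)
  define p where "p = a \<Up> g"
  have p [simp]: "p \<in> carrier G" using g by (simp add: p_def)
  have 1: "a \<Up> p \<Up> a = a \<Up> p"
    using left_3_engel_commutes_conj[OF a g] by (simp add: p_def)
  have "a \<Up> (a \<Up> (inv g)) \<Up> a \<Up> g = a \<Up> (a \<Up> (inv g)) \<Up> g"
    using left_3_engel_commutes_conj[OF a, of "inv g"] g by simp
  moreover have "a \<Up> (a \<Up> (inv g)) \<Up> g = p \<Up> a"
    using g by (simp add: p_def conjugate_def free_reduce)
  moreover have "a \<Up> (a \<Up> (inv g)) \<Up> a \<Up> g = p \<Up> a \<Up> p"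
    using g by (simp add: p_def conjugate_def free_reduce)
  ultimately have 2: "p \<Up> a \<Up> p = p \<Up> a" by simp
  have "commutator G p a = inv (a \<Up> p) \<otimes> a"
    by (simp add: commutator_def conjugate_def free_reduce)
  then show "commutator G (a \<Up> g) a \<Up> a = commutator G (a \<Up> g) a"
    by (simp add: conj_mult conj_inv 1 flip: p_def)
  show "commutator G (a \<Up> g) a \<Up> (a \<Up> g) = commutator G (a \<Up> g) a"
    by (simp add: commutator_eq_conj conj_mult conj_inv 2 flip: p_def)
qed

end

section \<open>Two left 3-Engel elements\<close>

text \<open>
  A locale makes the symmetry between \<open>a\<close> and \<open>b\<close> available: every result below also holds for its
  interpretation with \<open>a\<close> and \<open>b\<close> exchanged.
\<close>

locale left_3_engel_pair = group G for G :: "('a, 'b) monoid_scheme" (structure) +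
  fixes a b :: 'a
  assumes a_engel: "a \<in> left_engel_set G 3" and b_engel: "b \<in> left_engel_set G 3"
begin

text \<open>
  The inverse in \<open>t'\<close> makes \<open>t\<close> and \<open>t'\<close> mirror images: exchanging \<open>a\<close> and \<open>b\<close> turns \<open>u\<close>, \<open>v\<close>, \<open>w\<close>
  into \<open>u\<^sup>-\<^sup>1\<close>, \<open>w\<^sup>-\<^sup>1\<close>, \<open>v\<^sup>-\<^sup>1\<close>. The elements \<open>z\<close> and \<open>y\<close> are needed because \<open>w\<^sup>a\<close> and \<open>v\<^sup>b\<close> are most
  simply described through them.
\<close>

definition u where "u = commutator G a b"
definition v where "v = commutator G u a"
definition w where "w = commutator G u b"
definition t where "t = commutator G w a"
definition t' where "t' = commutator G (inv v) b"
definition s where "s = commutator G t a"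
definition z where "z = v \<Up> (inv b)"
definition y where "y = w \<Up> (inv a)"

lemma closed [simp]:
  "a \<in> carrier G" "b \<in> carrier G" "u \<in> carrier G" "v \<in> carrier G" "w \<in> carrier G"
  "t \<in> carrier G" "t' \<in> carrier G" "s \<in> carrier G" "z \<in> carrier G" "y \<in> carrier G"
  using a_engel b_engel
  by (auto simp: left_engel_set_def u_def v_def w_def t_def t'_def s_def z_def y_def)

lemma conj_a_b: "a \<Up> b = a \<otimes> u"
  by (simp add: u_def conj_eq_mult_commutator)
lemma conj_b_a: "b \<Up> a = b \<otimes> inv u"
  by (simp add: u_def conj_eq_mult_commutator inv_commutator)
lemma conj_u_a: "u \<Up> a = u \<otimes> v"
  by (simp add: v_def conj_eq_mult_commutator)
lemma conj_u_b: "u \<Up> b = u \<otimes> w"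
  by (simp add: w_def conj_eq_mult_commutator)
lemma conj_w_a: "w \<Up> a = w \<otimes> t"
  by (simp add: t_def conj_eq_mult_commutator)
lemma conj_t_a: "t \<Up> a = t \<otimes> s"
  by (simp add: s_def conj_eq_mult_commutator)

lemma v_eq: "v = commutator G (a \<Up> b) a"
  by (simp add: v_def u_def commutator_def conjugate_def free_reduce)
lemma w_eq: "w = inv (commutator G (b \<Up> a) b)"
proof -
  let ?c = "commutator G (b \<Up> a) b"
  have "w = inv (?c \<Up> (inv (b \<Up> a))) \<Up> b"
    by (simp add: w_def u_def commutator_def conjugate_def free_reduce)
  also have "?c \<Up> (inv (b \<Up> a)) = ?c"
    using left_3_engel_class_2(2)[OF b_engel, of a] by (subst conj_inv_eq_self) simp_all
  also have "inv ?c \<Up> b = inv ?c"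
    using left_3_engel_class_2(1)[OF b_engel, of a] by (simp add: conj_inv)
  finally show ?thesis .
qed

lemma conj_v_a: "v \<Up> a = v"
  using left_3_engel_class_2(1)[OF a_engel, of b] by (simp add: v_eq)
lemma conj_v_a': "v \<Up> (a \<Up> b) = v"
  using left_3_engel_class_2(2)[OF a_engel, of b] by (simp add: v_eq)
lemma conj_w_b: "w \<Up> b = w"
  using left_3_engel_class_2(1)[OF b_engel, of a] by (simp add: w_eq conj_inv)
lemma conj_w_b': "w \<Up> (b \<Up> a) = w"
  using left_3_engel_class_2(2)[OF b_engel, of a] by (simp add: w_eq conj_inv)

lemma conj_v_u: "v \<Up> u = v"
  using conj_v_a' conj_v_a by (simp add: conj_a_b flip: conj_conj)
lemma conj_w_u: "w \<Up> u = w"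
  using conj_w_b' conj_w_b by (simp add: conj_b_a conj_inv_eq_self flip: conj_conj)

lemma u_v: "v \<otimes> u = u \<otimes> v" and u_w: "w \<otimes> u = u \<otimes> w"
  using conj_v_u conj_w_u by (simp_all add: conj_eq_self_iff)

lemma conj_z_b: "z \<Up> b = v"
  by (simp add: z_def)

text \<open>
  This is the conjugate by \<open>b\<^sup>-\<^sup>1\<close> of the fact that \<open>v\<close> commutes with \<open>a\<^sup>b\<close>.
\<close>

lemma conj_z_a: "z \<Up> a = z"
proof -
  have "z \<Up> a \<Up> b = v \<Up> (a \<Up> b)"
    by (simp add: z_def conjugate_def free_reduce)
  then show ?thesis
    by (metis conj_v_a' conj_z_b conj_inject closed conj_closed)
qed

lemma conj_b_a_u: "x \<in> carrier G \<Longrightarrow> x \<Up> b \<Up> a \<Up> u = x \<Up> a \<Up> b"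
  by (simp add: conj_conj u_def commutator_def free_reduce)

text \<open>
  Conjugation by \<open>a b\<close> agrees with conjugation by \<open>b a\<close> followed by \<open>u\<close>. Applied to \<open>u\<close> itself this
  is a relation of Hall-Witt type between \<open>w\<^sup>a\<close> and \<open>v\<^sup>b\<close>. It has two forms, because \<open>u\<close> commutes
  with \<open>v\<close> and \<open>w\<close>: \<open>u\<close> can be cancelled on the left when it is written first in \<open>u v\<close> and
  \<open>u w\<close>, and on the right when it is written last.
\<close>

lemma hall_witt_1: "z \<otimes> w \<Up> a = w \<otimes> v"
proof -
  have "(u \<otimes> w) \<Up> a \<Up> u = (u \<otimes> v) \<Up> b"
    using conj_b_a_u[of u] by (simp add: conj_u_a conj_u_b)
  then have "u \<otimes> (v \<otimes> w \<Up> a \<Up> u) = u \<otimes> (w \<otimes> v \<Up> b)"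
    by (simp add: conj_mult conj_u_a conj_u_b conj_v_u m_assoc)
  moreover have "w \<Up> a \<Up> b = w \<Up> a \<Up> u"
    using conj_b_a_u[of w] by (simp add: conj_w_b)
  ultimately have "(z \<otimes> w \<Up> a) \<Up> b = (w \<otimes> v) \<Up> b"
    by (simp add: conj_mult conj_z_b conj_w_b)
  then show ?thesis by (simp add: conj_inject)
qed

lemma hall_witt_2: "w \<Up> a \<otimes> z = v \<otimes> w"
proof -
  have "(w \<otimes> u) \<Up> a \<Up> u = (v \<otimes> u) \<Up> b"
    using conj_b_a_u[of u] by (simp add: conj_u_a conj_u_b u_v u_w)
  then have "w \<Up> a \<Up> u \<otimes> (u \<otimes> v) = v \<Up> b \<otimes> (u \<otimes> w)"
    by (simp add: conj_mult conj_u_a conj_u_b conj_v_u)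
  then have "w \<Up> a \<Up> u \<otimes> v \<otimes> u = v \<Up> b \<otimes> w \<otimes> u"
    by (simp add: m_assoc u_v u_w)
  moreover have "w \<Up> a \<Up> b = w \<Up> a \<Up> u"
    using conj_b_a_u[of w] by (simp add: conj_w_b)
  ultimately have "(w \<Up> a \<otimes> z) \<Up> b = (v \<otimes> w) \<Up> b"
    by (simp add: conj_mult conj_z_b conj_w_b)
  then show ?thesis by (simp add: conj_inject)
qed

lemma conj_v_w: "v \<Up> w = t \<otimes> z"
proof -
  have "v \<Up> w = inv w \<otimes> (w \<Up> a \<otimes> z)"
    by (simp add: hall_witt_2 conjugate_def[of v] m_assoc)
  then show ?thesis
    by (simp add: conj_w_a m_assoc inv_mult_cancel)
qed

lemma conj_z_w: "z \<Up> w = v \<otimes> inv t"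
proof -
  have "z \<Up> w \<otimes> t = v"
  proof -
    have "z \<Up> w \<otimes> t = inv w \<otimes> (z \<otimes> w \<Up> a)"
      by (simp add: conj_w_a conjugate_def[of z] m_assoc)
    then show ?thesis
      by (simp add: hall_witt_1 inv_mult_cancel)
  qed
  then show ?thesis by (simp add: inv_solve_right)
qed

lemma y_eqs: "z \<otimes> w = y \<otimes> v" "w \<otimes> z = v \<otimes> y"
proof -
  have *: "y \<Up> a = w" by (simp add: y_def)
  have "(z \<otimes> w) \<Up> a = (y \<otimes> v) \<Up> a" "(w \<otimes> z) \<Up> a = (v \<otimes> y) \<Up> a"
    using hall_witt_1 hall_witt_2 by (simp_all add: conj_mult conj_z_a conj_v_a *)
  then show "z \<otimes> w = y \<otimes> v" "w \<otimes> z = v \<otimes> y"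
    by (simp_all add: conj_inject)
qed

text \<open>
  The equations for \<open>y\<close> give \<open>(v z)\<^sup>w = z v\<close>, while \<open>conj_v_w\<close> and \<open>conj_z_w\<close> give
  \<open>(v z)\<^sup>w = t (z v) t\<^sup>-\<^sup>1\<close>.
\<close>

lemma conj_t_zv: "t \<Up> z \<Up> v = t"
proof -
  have "(v \<otimes> z) \<Up> w = inv w \<otimes> (v \<otimes> (z \<otimes> w))"
    by (simp add: conjugate_def m_assoc)
  also have "\<dots> = z \<otimes> v"
    by (metis y_eqs closed m_assoc m_closed inv_mult_cancel)
  finally have "t \<otimes> (z \<otimes> v) \<otimes> inv t = z \<otimes> v"
    by (simp add: conj_mult conj_v_w conj_z_w m_assoc)
  then have "t \<otimes> (z \<otimes> v) = (z \<otimes> v) \<otimes> t"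
    by (simp add: inv_solve_right')
  then show ?thesis
    by (simp add: conj_conj conj_eq_self_iff)
qed

lemma conj_a_w: "a \<Up> w = a \<otimes> inv t"
  by (simp add: t_def inv_commutator conj_eq_mult_commutator)

text \<open>
  Since \<open>a\<^sup>w = a t\<^sup>-\<^sup>1\<close>, the commutator of \<open>a\<^sup>w\<close> and \<open>a\<close> is \<open>[t\<^sup>-\<^sup>1, a]\<close>, a conjugate of \<open>s\<^sup>-\<^sup>1\<close>. It
  commutes with \<open>a\<close> and \<open>a\<^sup>w\<close>, hence with \<open>t\<close>, and therefore equals \<open>s\<^sup>-\<^sup>1\<close>.
\<close>

lemma conj_s: "s \<Up> a = s" "s \<Up> t = s"
proof -
  define c where "c = commutator G (a \<Up> w) a"
  have c [simp]: "c \<in> carrier G" by (simp add: c_def)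
  have c_eq: "c = inv (s \<Up> (inv t))"
    unfolding c_def conj_a_w s_def by (simp add: commutator_def conjugate_def free_reduce)
  have 1: "c \<Up> a = c" and 2: "c \<Up> (a \<Up> w) = c"
    using left_3_engel_class_2[OF a_engel, of w] by (simp_all add: c_def)
  have "c \<Up> t = c"
    using 2 by (simp add: 1 conj_a_w conj_inv_eq_self flip: conj_conj)
  moreover have "c \<Up> t = inv s"
    by (simp add: c_eq conj_inv)
  ultimately have "s = inv c" by (metis closed(8) inv_inv)
  then show "s \<Up> a = s" "s \<Up> t = s"
    using 1 \<open>c \<Up> t = c\<close> by (simp_all add: conj_inv)
qed

lemma conj_t_s: "t \<Up> s = t"
  using conj_s by (simp add: conj_eq_self_sym)

text \<open>
  As \<open>z\<close> commutes with \<open>a\<close>, its conjugate \<open>z\<^sup>w = v t\<^sup>-\<^sup>1\<close> commutes with \<open>a\<^sup>w = a t\<^sup>-\<^sup>1\<close>. So \<open>v\<close> and \<open>t\<close>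
  conjugate \<open>a t\<^sup>-\<^sup>1\<close> to the same element, and \<open>v\<close> fixes \<open>a\<close>.
\<close>

lemma conj_t_v: "t \<Up> v = t \<otimes> s"
proof -
  have "(z \<Up> a) \<Up> w = z \<Up> w \<Up> (a \<Up> w)"
    by (simp add: conjugate_def free_reduce)
  then have "(a \<otimes> inv t) \<Up> (v \<otimes> inv t) = a \<otimes> inv t"
    unfolding conj_z_a conj_z_w conj_a_w by (subst conj_eq_self_sym) simp_all
  then have "(a \<otimes> inv t) \<Up> v = (a \<otimes> inv t) \<Up> t"
    by (metis closed conj_cancel(2) conj_conj inv_closed m_closed conj_closed)
  then have "a \<otimes> inv (t \<Up> v) = a \<Up> t \<otimes> inv t"
    using conj_v_a by (simp add: conj_mult conj_inv conj_eq_self_sym)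
  also have "\<dots> = a \<otimes> inv (t \<otimes> s)"
    by (simp add: conj_eq_mult_commutator s_def m_assoc inv_mult_group inv_commutator)
  finally have "inv (t \<Up> v) = inv (t \<otimes> s)" by simp
  then show ?thesis
    by (metis closed conj_closed inv_inv m_closed)
qed

lemma conj_s_v: "s \<Up> v = s"
proof -
  have "s \<Up> v = commutator G (t \<Up> v) (a \<Up> v)"
    by (simp add: s_def conj_commutator)
  also have "\<dots> = commutator G (t \<otimes> s) a"
    using conj_v_a by (simp add: conj_t_v conj_eq_self_sym)
  also have "\<dots> = s"
    by (simp add: commutator_eq_conj conj_mult conj_t_a conj_s inv_mult_cancel)
  finally show ?thesis .
qed

lemma conj_t_z: "t \<Up> z = t \<otimes> inv s"
proof -
  have "(t \<otimes> inv s) \<Up> v = t \<Up> z \<Up> v"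
    by (simp add: conj_mult conj_inv conj_t_v conj_s_v conj_t_zv m_assoc)
  then show ?thesis
    by (simp add: conj_inject)
qed

lemma conj_s_z: "s \<Up> z = s"
proof -
  have "s \<Up> z = commutator G (t \<Up> z) (a \<Up> z)"
    by (simp add: s_def conj_commutator)
  also have "\<dots> = commutator G (t \<otimes> inv s) a"
    using conj_z_a by (simp add: conj_t_z conj_eq_self_sym)
  also have "\<dots> = s"
    by (simp add: commutator_eq_conj conj_mult conj_inv conj_t_a conj_s free_reduce)
  finally show ?thesis .
qed

lemma s_commute:
  "s \<otimes> t = t \<otimes> s" "s \<otimes> z = z \<otimes> s"
  "inv s \<otimes> t = t \<otimes> inv s" "inv s \<otimes> z = z \<otimes> inv s"
  using conj_s conj_s_z by (simp_all add: conj_eq_self_iff[symmetric] conj_inv)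

lemma s_left_commute:
  "x \<in> carrier G \<Longrightarrow> s \<otimes> (t \<otimes> x) = t \<otimes> (s \<otimes> x)"
  "x \<in> carrier G \<Longrightarrow> s \<otimes> (z \<otimes> x) = z \<otimes> (s \<otimes> x)"
  "x \<in> carrier G \<Longrightarrow> inv s \<otimes> (t \<otimes> x) = t \<otimes> (inv s \<otimes> x)"
  "x \<in> carrier G \<Longrightarrow> inv s \<otimes> (z \<otimes> x) = z \<otimes> (inv s \<otimes> x)"
  by (simp_all add: s_commute flip: m_assoc)

lemma conj_y_b: "y \<Up> b = y"
proof -
  have "y \<Up> b = w \<Up> (b \<Up> a) \<Up> (inv a)"
    by (simp add: y_def conjugate_def free_reduce)
  then show ?thesis
    by (simp add: conj_w_b' y_def)
qed

text \<open>
  Conjugating \<open>z w = y v\<close> by \<open>b\<close>, which fixes \<open>w\<close> and \<open>y\<close> and maps \<open>z\<close> to \<open>v\<close>, gives \<open>v\<^sup>b = y\<^sup>-\<^sup>1 v w\<close>;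
  the other equation for \<open>y\<close> turns this into \<open>z\<^sup>-\<^sup>1 v\<^sup>w v\<^sup>w\<close>, and \<open>v\<^sup>w = t z\<close>.
\<close>

lemma conj_v_b: "v \<Up> b = t \<otimes> t \<otimes> inv s \<otimes> z"
proof -
  have "v \<otimes> w = y \<otimes> v \<Up> b"
    using arg_cong[OF y_eqs(1), of "\<lambda>x. x \<Up> b"]
    by (simp add: conj_mult conj_z_b conj_w_b conj_y_b)
  then have "v \<Up> b = inv y \<otimes> (v \<otimes> w)"
    by (simp add: inv_mult_cancel)
  also have "y = inv v \<otimes> (w \<otimes> z)"
    by (simp add: y_eqs(2) inv_mult_cancel)
  also have "inv (inv v \<otimes> (w \<otimes> z)) \<otimes> (v \<otimes> w) = inv z \<otimes> (v \<Up> w \<otimes> v \<Up> w)"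
    by (simp add: conjugate_def free_reduce)
  also have "\<dots> = t \<Up> z \<otimes> t \<otimes> z"
    by (simp add: conj_v_w) (simp add: conjugate_def m_assoc)
  also have "\<dots> = t \<otimes> t \<otimes> inv s \<otimes> z"
    by (simp add: conj_t_z m_assoc s_commute s_left_commute)
  finally show ?thesis .
qed

text \<open>
  The commutator of \<open>a\<close> with its conjugate by \<open>b\<^sup>2\<close> is \<open>t z t z t\<close>. It commutes with \<open>a\<close>, and
  conjugation by \<open>a\<close> fixes \<open>z\<close> and multiplies each of the three factors \<open>t\<close> by \<open>s\<close>.
\<close>

lemma s_cube: "s \<otimes> s \<otimes> s = \<one>"
proof -
  define e where "e = commutator G (a \<Up> (b \<otimes> b)) a"
  have "a \<Up> (b \<otimes> b) = a \<otimes> (u \<otimes> u \<otimes> w)"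
    by (simp add: conj_a_b conj_u_b conj_mult m_assoc flip: conj_conj)
  then have "e = commutator G (u \<otimes> u \<otimes> w) a"
    by (simp add: e_def commutator_def free_reduce)
  also have "\<dots> = inv w \<otimes> (inv u \<otimes> (v \<otimes> (u \<otimes> (v \<otimes> (w \<otimes> t)))))"
    by (simp add: commutator_eq_conj conj_mult conj_u_a conj_w_a free_reduce)
  also have "v \<otimes> (u \<otimes> (v \<otimes> (w \<otimes> t))) = u \<otimes> (v \<otimes> (v \<otimes> (w \<otimes> t)))"
    by (simp add: u_v flip: m_assoc)
  also have "inv w \<otimes> (inv u \<otimes> (u \<otimes> (v \<otimes> (v \<otimes> (w \<otimes> t))))) = v \<Up> w \<otimes> v \<Up> w \<otimes> t"
    by (simp add: conjugate_def free_reduce)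
  also have "\<dots> = t \<otimes> z \<otimes> t \<otimes> z \<otimes> t"
    by (simp add: conj_v_w m_assoc)
  finally have e: "e = t \<otimes> z \<otimes> t \<otimes> z \<otimes> t" .
  have "e = e \<Up> a"
    using left_3_engel_class_2(1)[OF a_engel, of "b \<otimes> b"] by (simp add: e_def)
  also have "\<dots> = e \<otimes> (s \<otimes> s \<otimes> s)"
    by (simp add: e conj_mult conj_t_a conj_z_a m_assoc s_commute s_left_commute)
  finally show ?thesis
    by (metis closed(8) e closed m_closed r_cancel_one' l_cancel_one')
qed

lemma inv_s_square: "inv s \<otimes> inv s = s"
proof -
  have "inv s = s \<otimes> s"
    using s_cube by (simp add: inv_equality)
  then have "inv s \<otimes> inv s = inv s \<otimes> (s \<otimes> s)" by simp
  then show ?thesis by (simp add: inv_mult_cancel)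
qed

text \<open>
  From \<open>t = (z\<^sup>w)\<^sup>-\<^sup>1 v\<close> the value of \<open>t\<^sup>b\<close> is \<open>t s\<^sup>-\<^sup>2\<close>, which is \<open>t s\<close> since \<open>s\<close> has order dividing 3.
\<close>

lemma conj_t_b: "t \<Up> b = t \<otimes> s"
proof -
  have "t = inv (z \<Up> w) \<otimes> v"
    by (simp add: conj_z_w free_reduce)
  also have "(\<dots>) \<Up> b = inv (z \<Up> b \<Up> w) \<otimes> v \<Up> b"
    using conj_w_b by (simp add: conj_mult conj_inv conj_conj conj_eq_self_iff)
  also have "\<dots> = inv z \<otimes> (t \<otimes> inv s \<otimes> z)"
    by (simp add: conj_z_b conj_v_w conj_v_b free_reduce)
  also have "\<dots> = t \<Up> z \<otimes> inv s"
    by (simp add: conjugate_def m_assoc s_commute)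
  also have "\<dots> = t \<otimes> s"
    by (simp add: conj_t_z m_assoc inv_s_square)
  finally show ?thesis .
qed

text \<open>
  Conjugate the relation \<open>t\<^sup>v = t s\<close> by \<open>b\<close>. On the left this replaces \<open>v\<close> by \<open>v\<^sup>b\<close>, which acts on
  \<open>t\<close> like \<open>z\<close>, that is, by \<open>s\<^sup>-\<^sup>1\<close> instead of \<open>s\<close>; on the right \<open>t\<^sup>b = t s\<close> is known.
\<close>

lemma conj_s_b: "s \<Up> b = inv s"
proof -
  have "t \<otimes> s \<otimes> s \<Up> b = (t \<Up> v) \<Up> b"
    by (simp add: conj_t_v conj_mult conj_t_b)
  also have "\<dots> = t \<Up> b \<Up> (v \<Up> b)"
    by (simp add: conjugate_def free_reduce)
  also have "\<dots> = t"
  proof -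
    have "t \<Up> (inv s) = t" "s \<Up> (inv s) = s"
      by (simp_all add: conj_inv_eq_self conj_t_s)
    then show ?thesis
      by (simp add: conj_t_b conj_v_b conj_mult conj_t_z conj_s_z conj_s conj_t_s m_assoc
          flip: conj_conj)
  qed
  finally have "s \<otimes> s \<Up> b = \<one>"
    by (simp add: m_assoc)
  then show ?thesis
    by (metis closed(8) closed(2) conj_closed inv_equality inv_inv)
qed

lemma conj_t'_a: "t' \<Up> a = t' \<otimes> s"
proof -
  have t': "t' = v \<otimes> inv (v \<Up> b)"
    by (simp add: t'_def commutator_eq_conj conj_inv)
  have "v \<Up> b \<Up> a = s \<otimes> s \<otimes> v \<Up> b"
    by (simp add: conj_v_b conj_mult conj_inv conj_t_a conj_z_a conj_s m_assoc s_commute s_left_commute)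
  then have "t' \<Up> a = v \<otimes> (inv (v \<Up> b) \<otimes> (inv s \<otimes> inv s))"
    by (simp add: t' conj_mult conj_inv conj_v_a inv_mult_group m_assoc)
  then show ?thesis
    by (simp add: inv_s_square t' m_assoc)
qed

lemma swap: "left_3_engel_pair G b a"
  using a_engel b_engel by unfold_locales

text \<open>
  The symmetry argument: \<open>s\<close> is its own mirror image, so it is both inverted and fixed by \<open>a\<close>. Being
  of order dividing 2 and 3, it is trivial.
\<close>

lemma t_t'_central:
  "commutator G t a = \<one>" "commutator G t b = \<one>" "commutator G t' a = \<one>" "commutator G t' b = \<one>"
proof -
  interpret swap: left_3_engel_pair G b a by (rule swap)
  have u: "swap.u = inv u"
    by (simp add: swap.u_def u_def inv_commutator)
  have v: "swap.v = inv w"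
    by (simp add: swap.v_def u commutator_eq_conj conj_inv conj_u_b free_reduce flip: u_w)
  have w: "swap.w = inv v"
    by (simp add: swap.w_def u commutator_eq_conj conj_inv conj_u_a free_reduce flip: u_v)
  have t: "swap.t = t'"
    by (simp add: swap.t_def t'_def w)
  have "t' \<otimes> swap.s = t' \<otimes> s"
    using swap.conj_t_b conj_t'_a by (simp add: t)
  then have s: "swap.s = s" by simp
  have "inv s = s"
    using swap.conj_s_b conj_s by (simp add: s)
  then have s1: "s = \<one>"
    using s_cube by (metis closed(8) l_inv l_one)
  show "commutator G t a = \<one>" "commutator G t b = \<one>"
     "commutator G t' a = \<one>" "commutator G t' b = \<one>"
    using conj_t_a conj_t_b conj_t'_a swap.conj_t_a by (simp_all add: commutator_eq_iff s t s1)
qed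

end

section \<open>Nilpotency through the upper central series\<close>

primrec upper_central_series :: "('a, 'b) monoid_scheme \<Rightarrow> nat \<Rightarrow> 'a set" where
  "upper_central_series G 0 = {\<one>\<^bsub>G\<^esub>}"
| "upper_central_series G (Suc n) =
     {x \<in> carrier G. \<forall>g \<in> carrier G. commutator G x g \<in> upper_central_series G n}"

context group
begin

lemma commutator_mult_left:
  "\<lbrakk>x \<in> carrier G; y \<in> carrier G; g \<in> carrier G\<rbrakk>
    \<Longrightarrow> commutator G (x \<otimes> y) g = commutator G x g \<Up> y \<otimes> commutator G y g"
  by (simp add: commutator_def conjugate_def free_reduce)

lemma commutator_mult_right:
  "\<lbrakk>x \<in> carrier G; g \<in> carrier G; h \<in> carrier G\<rbrakk>
    \<Longrightarrow> commutator G x (g \<otimes> h) = commutator G x h \<otimes> commutator G x g \<Up> h"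
  by (simp add: commutator_def conjugate_def free_reduce)

lemma commutator_inv_left:
  "\<lbrakk>x \<in> carrier G; g \<in> carrier G\<rbrakk>
    \<Longrightarrow> commutator G (inv x) g = inv (commutator G x g) \<Up> (inv x)"
  by (simp add: commutator_def conjugate_def free_reduce)

lemma commutator_inv_right:
  "\<lbrakk>x \<in> carrier G; g \<in> carrier G\<rbrakk>
    \<Longrightarrow> commutator G x (inv g) = inv (commutator G x g) \<Up> (inv g)"
  by (simp add: commutator_def conjugate_def free_reduce)

lemma upper_central_series_closed: "x \<in> upper_central_series G n \<Longrightarrow> x \<in> carrier G"
  by (cases n) auto

text \<open>
  The subgroup property of one term uses invariance of the previous term under conjugation, so both
  properties are proved in one induction.
\<close>

lemma upper_central_series_subgroup_conj:
  "subgroup (upper_central_series G n) G \<and>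
   (\<forall>x \<in> upper_central_series G n. \<forall>g \<in> carrier G. x \<Up> g \<in> upper_central_series G n)"
proof (induction n)
  case 0
  then show ?case by (simp add: triv_subgroup)
next
  case (Suc n)
  let ?Z = "upper_central_series G n"
  interpret Z: subgroup ?Z G using Suc by simp
  have conj: "x \<Up> g \<in> ?Z" if "x \<in> ?Z" "g \<in> carrier G" for x g
    using Suc that by blast
  have "subgroup (upper_central_series G (Suc n)) G"
    by (rule subgroupI)
      (auto simp: commutator_mult_left commutator_inv_left conj commutator_eq_conj[of \<one>]
        intro!: exI[of _ \<one>])
  moreover have "x \<Up> g \<in> upper_central_series G (Suc n)"
    if x: "x \<in> upper_central_series G (Suc n)" and g: "g \<in> carrier G" for x g
  proof -
    have "commutator G (x \<Up> g) h = commutator G x (h \<Up> (inv g)) \<Up> g" if "h \<in> carrier G" for h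
      using x g that by (simp add: conj_commutator)
    then show ?thesis
      using x g by (auto intro: conj)
  qed
  ultimately show ?case by blast
qed

lemmas subgroup_upper_central_series = upper_central_series_subgroup_conj[THEN conjunct1]

text \<open>
  Modulo a normal subgroup the elements commuting with \<open>x\<close> form a subgroup, so it suffices to test
  commutators of \<open>x\<close> with generators.
\<close>

lemma upper_central_series_SucI:
  assumes gen: "generate G S = carrier G" and x: "x \<in> carrier G"
    and S: "\<And>g. g \<in> S \<Longrightarrow> commutator G x g \<in> upper_central_series G n"
  shows "x \<in> upper_central_series G (Suc n)"
proof -
  let ?Z = "upper_central_series G n"
  interpret Z: subgroup ?Z G by (rule subgroup_upper_central_series)
  have conj: "x \<Up> g \<in> ?Z" if "x \<in> ?Z" "g \<in> carrier G" for x g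
    using upper_central_series_subgroup_conj that by blast
  have S': "S \<subseteq> carrier G"
    using gen by (auto intro: generate.incl)
  have "commutator G x g \<in> ?Z" if "g \<in> generate G S" for g
    using that
  proof (induction rule: generate.induct)
    case one
    then show ?case using x by (simp add: commutator_eq_conj)
  next
    case (incl g)
    then show ?case by (rule S)
  next
    case (inv g)
    then have "g \<in> carrier G" using S' by auto
    then show ?case using S[OF inv] x by (auto simp: commutator_inv_right intro!: conj)
  next
    case (eng g h)
    then show ?case using x gen by (auto simp: commutator_mult_right intro!: conj)
  qed
  then show ?thesis using x gen by simp
qed

lemma nilpotent_class_leI:
  assumes "upper_central_series G n = carrier G"
  shows "nilpotent_class_le G n"
proof -
  have "lower_central_series G i \<subseteq> upper_central_series G (n - i)" if "i \<le> n" for i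
    using that
  proof (induction i)
    case 0
    then show ?case using assms by simp
  next
    case (Suc i)
    have "n - i = Suc (n - Suc i)" using Suc.prems by simp
    then have "lower_central_series G i \<subseteq> upper_central_series G (Suc (n - Suc i))"
      using Suc by simp
    then have "{commutator G x y |x y. x \<in> lower_central_series G i \<and> y \<in> carrier G}
        \<subseteq> upper_central_series G (n - Suc i)"
      by auto
    then show ?case
      using generate_subgroup_incl[OF _ subgroup_upper_central_series] by simp
  qed
  from this[of n] have "lower_central_series G n \<subseteq> {\<one>}" by simp
  moreover have "\<one> \<in> lower_central_series G n"
    by (cases n) (simp_all add: generate.one)
  ultimately show ?thesis
    by (auto simp: nilpotent_class_le_def is_group)
qed

end

section \<open>The nilpotency class of the generated subgroup\<close>

lemma (in left_3_engel_pair) nilpotent_class_le_4: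
  assumes gen: "generate G {a, b} = carrier G"
  shows "nilpotent_class_le G 4"
proof (rule nilpotent_class_leI)
  let ?Z = "upper_central_series G"
  have one: "\<one> \<in> ?Z n" and inv: "x \<in> ?Z n \<Longrightarrow> inv x \<in> ?Z n" for n x
    using subgroup_upper_central_series[of n]
    by (auto intro: subgroup.one_closed subgroup.m_inv_closed)
  have step: "x \<in> ?Z (Suc n)"
    if "x \<in> carrier G" "commutator G x a \<in> ?Z n" "commutator G x b \<in> ?Z n" for x n
    using upper_central_series_SucI[OF gen, of x n] that by blast
  have t: "t \<in> ?Z (Suc 0)" and t': "t' \<in> ?Z (Suc 0)"
    by (rule step; simp add: t_t'_central)+
  have v: "inv v \<in> ?Z (Suc (Suc 0))"
  proof (rule step)
    have "commutator G (inv v) a = \<one>"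
      by (simp add: commutator_eq_iff conj_inv conj_v_a)
    then show "commutator G (inv v) a \<in> ?Z (Suc 0)"
      by (simp only: one)
    show "commutator G (inv v) b \<in> ?Z (Suc 0)"
      using t' by (simp only: t'_def)
  qed simp
  have w: "w \<in> ?Z (Suc (Suc 0))"
  proof (rule step)
    have "commutator G w b = \<one>"
      by (simp add: commutator_eq_iff conj_w_b)
    then show "commutator G w b \<in> ?Z (Suc 0)"
      by (simp only: one)
    show "commutator G w a \<in> ?Z (Suc 0)"
      using t by (simp only: t_def)
  qed simp
  have u: "u \<in> ?Z (Suc (Suc (Suc 0)))"
  proof (rule step)
    show "commutator G u a \<in> ?Z (Suc (Suc 0))"
      using inv[OF v] by (simp only: v_def[symmetric] inv_inv closed)
    show "commutator G u b \<in> ?Z (Suc (Suc 0))"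
      using w by (simp only: w_def)
  qed simp
  have "commutator G a a = \<one>" "commutator G b b = \<one>" "commutator G b a = inv u"
    by (simp_all add: commutator_eq_iff u_def inv_commutator)
  then have "commutator G x g \<in> ?Z (Suc (Suc (Suc 0)))" if "x \<in> {a, b}" "g \<in> {a, b}" for x g
    using that u inv[OF u] one[of "Suc (Suc (Suc 0))"] u_def by (elim insertE emptyE) metis+
  then have "{a, b} \<subseteq> ?Z (Suc (Suc (Suc (Suc 0))))"
    using step[of _ "Suc (Suc (Suc 0))"] closed(1,2) by blast
  then have "carrier G \<subseteq> ?Z 4"
    unfolding eval_nat_numeral BitM.simps One_nat_def gen[symmetric]
    by (rule generate_subgroup_incl[OF _ subgroup_upper_central_series])
  then show "?Z 4 = carrier G"
    using upper_central_series_closed by blast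
qed

text \<open>
  The Engel condition, inverses, commutators and generation pass from \<open>G\<close> to the subgroup generated
  by \<open>a\<close> and \<open>b\<close>, so the previous lemma applies to that subgroup as a group in its own right.
\<close>

theorem theorem1p2:
  fixes G :: "('a, 'b) monoid_scheme" and a b :: 'a
  assumes "group G"
    and "a \<in> left_engel_set G 3"
    and "b \<in> left_engel_set G 3"
  shows "nilpotent_class_le (G\<lparr>carrier := generate G {a, b}\<rparr>) 4"
proof -
  interpret group G by fact
  have ab: "{a, b} \<subseteq> carrier G"
    using assms by (auto simp: left_engel_set_def)
  let ?S = "generate G {a, b}" and ?H = "G\<lparr>carrier := generate G {a, b}\<rparr>"
  interpret S: subgroup ?S G
    by (rule generate_is_subgroup[OF ab])
  interpret H: group ?H
    by (rule S.subgroup_is_group) fact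
  have inv: "inv\<^bsub>?H\<^esub> x = inv\<^bsub>G\<^esub> x" if "x \<in> ?S" for x
    using that S.subgroup_axioms by simp
  have comm: "commutator ?H x y = commutator G x y" if "x \<in> ?S" "y \<in> ?S" for x y
    using that by (simp add: commutator_def inv)
  have comm_closed: "commutator G x y \<in> ?S" if "x \<in> ?S" "y \<in> ?S" for x y
    using that by (simp add: commutator_def)
  have iter: "iter_commutator ?H n x y = iter_commutator G n x y \<and> iter_commutator G n x y \<in> ?S"
    if "x \<in> ?S" "y \<in> ?S" for n x y
    using that by (induction n) (simp_all add: comm comm_closed)
  have "x \<in> left_engel_set ?H n" if "x \<in> left_engel_set G n" "x \<in> ?S" for x n
    using that S.subset by (auto simp: left_engel_set_def iter)
  moreover have "a \<in> ?S" "b \<in> ?S"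
    by (auto intro: generate.incl)
  ultimately interpret H: left_3_engel_pair ?H a b
    using assms by unfold_locales auto
  have "generate ?H {a, b} = ?S"
    by (rule generate_consistent) (auto intro: generate.incl S.subgroup_axioms)
  then show ?thesis
    by (intro H.nilpotent_class_le_4) simp
qed

end
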